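(* For all positive rationals $\alpha$ we have $n_\alpha\ge 66$.
   Context: For a positive rational $\alpha$ and a positive integer $n$, an $\alpha$-partition of $n$ is a finite set $\{a_1,\ldots,a_r\}$ of distinct positive integers with $a_1+\cdots+a_r=n$ and $\frac1{a_1}+\cdots+\frac1{a_r}=\alpha$. For a positive rational $\alpha$, $n_\alpha$ denotes the smallest positive integer such that for all integers $n\ge n_\alpha$ an $\alpha$-partition of $n$ exists (by a theorem of Graham, such an integer exists for every positive rational $\alpha$). *)

theory Defs
  imports Complex_Main "HOL-Library.Extended_Nat"
begin

definition alpha_partition :: "rat \<Rightarrow> nat \<Rightarrow> nat set \<Rightarrow> bool" where
  "alpha_partition \<alpha> n A \<longleftrightarrow>
     finite A \<and> (\<forall>a\<in>A. 0 < a) \<and> \<Sum>A = n \<and> (\<Sum>a\<in>A. 1 / of_nat a) = \<alpha>"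

definition eventually_partitionable :: "rat \<Rightarrow> nat \<Rightarrow> bool" where
  "eventually_partitionable \<alpha> N \<longleftrightarrow>
     0 < N \<and> (\<forall>n\<ge>N. \<exists>A. alpha_partition \<alpha> n A)"

(* Graham's theorem says that for every positive rational some N satisfies
   eventually_partitionable. Taking the smallest such N in enat makes n_alpha well
   defined without presupposing that theorem: the value would be \<infinity> if there were no
   such N. Otherwise it is the minimum, as n_alpha_eq_Least shows. *)
definition n_alpha :: "rat \<Rightarrow> enat" where
  "n_alpha \<alpha> = Inf (enat ` {N. eventually_partitionable \<alpha> N})"

lemma n_alpha_eq_Least:
  assumes "eventually_partitionable \<alpha> N"
  shows "n_alpha \<alpha> = enat (LEAST N. eventually_partitionable \<alpha> N)"
  unfolding n_alpha_def
proof (rule antisym)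
  show "Inf (enat ` {N. eventually_partitionable \<alpha> N})
      \<le> enat (LEAST N. eventually_partitionable \<alpha> N)"
    using LeastI[of "eventually_partitionable \<alpha>", OF assms] by (intro Inf_lower) simp
  show "enat (LEAST N. eventually_partitionable \<alpha> N)
      \<le> Inf (enat ` {N. eventually_partitionable \<alpha> N})"
    by (rule Inf_greatest) (auto intro: Least_le)
qed

end

theory Submission
  imports Defs "HOL-Computational_Algebra.Primes"
begin

text \<open>
  If \<open>n_alpha \<alpha>\<close> were at most 65, then \<open>\<alpha>\<close> would be the reciprocal sum of a partition of every
  \<open>n \<ge> 65\<close> into distinct parts. Already the fourteen values \<open>n = 65, \<dots>, 78\<close> make this
  impossible (\<open>blocked_long\<close>). Thirteen would not be enough: \<open>176/105\<close> has partitions of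
  \<open>65, \<dots>, 77\<close>, and fails only at \<open>78\<close>.

  The engine is a \<open>p\<close>-adic one. In a partition \<open>A\<close> with reciprocal sum \<open>\<alpha>\<close>, the parts prime to
  \<open>p\<close> contribute a rational without \<open>p\<close> in the denominator. Hence the reciprocal sum of the
  multiples of \<open>p\<close> in \<open>A\<close> is determined by \<open>\<alpha>\<close> up to such rationals, and the partitions of the
  different \<open>n\<close> in the window must agree in this residue.

  For a prime \<open>p \<ge> 17\<close>, the multiples \<open>p * k\<close> in a partition of \<open>n \<le> 84\<close> have cofactors \<open>k\<close> of
  total at most 4. There are only seven such sets of cofactors, and their reciprocal sums are
  incongruent modulo \<open>p\<close> (\<open>cofactors_forced\<close>). So every partition in the window contains the
  same multiples of \<open>p\<close>. Deleting them leaves partitions, with one common reciprocal sum, for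
  a window that starts lower. An induction over windows therefore excludes these primes
  (\<open>no_large_prime_divisor\<close>); it needs only that \<open>m, \<dots>, m + 5\<close> is a blocked window for every
  \<open>m \<le> 52\<close> (\<open>blocked_short\<close>).

  For the primes 13, 11, 7, 5, 3 several choices of multiples can share a residue, and a
  finite search keeps track of them. It treats one factor of the common denominator at a time.
  An option is a pair of the sum of the parts chosen so far and their scaled reciprocal sum;
  the options are split by residue, and a hypothetical \<open>\<alpha>\<close> lives in just one of the classes. A
  class dies if it has no option that fits the first \<open>n\<close> of the window, or if a single option
  serves the first six \<open>n\<close>: deleting the parts of that option leads again to a lower window,
  already known to be blocked. When only powers of two remain as possible parts, the rest of a
  partition is the binary expansion of what is missing to \<open>n\<close>, so the reciprocal sums
  attainable for each \<open>n\<close> can be listed and compared (\<open>search_fails_sound\<close>).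
\<close>

section \<open>Windows without a common reciprocal sum\<close>

definition blocked :: "nat \<Rightarrow> nat \<Rightarrow> bool" where
  "blocked a b \<longleftrightarrow> \<not> (\<exists>\<alpha>. \<forall>n\<in>{a..b}. \<exists>A. alpha_partition \<alpha> n A)"

section \<open>Primes from 17 on\<close>

definition cofactors :: "nat \<Rightarrow> nat set \<Rightarrow> nat set" where
  "cofactors p A = {k. p * k \<in> A}"

lemma partition_split:
  assumes A: "alpha_partition \<alpha> n A" and p: "0 < p"
  shows "finite (cofactors p A)" "0 \<notin> cofactors p A"
    "n = (\<Sum>{a \<in> A. \<not> p dvd a}) + p * (\<Sum>(cofactors p A))"
    "\<alpha> = (\<Sum>a | a \<in> A \<and> \<not> p dvd a. 1 / of_nat a) + (\<Sum>k\<in>cofactors p A. 1 / of_nat k) / of_nat p"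
proof -
  let ?T = "cofactors p A"
  let ?R = "{a \<in> A. \<not> p dvd a}"
  have fin: "finite A" and pos: "\<forall>a\<in>A. 0 < a" and sum: "\<Sum>A = n"
    and val: "(\<Sum>a\<in>A. 1 / of_nat a) = \<alpha>"
    using A by (auto simp: alpha_partition_def)
  have inj: "inj_on ((*) p) ?T" using p by (auto simp: inj_on_def)
  have A_eq: "A = ?R \<union> (*) p ` ?T" by (auto simp: cofactors_def)
  have disj: "?R \<inter> (*) p ` ?T = {}" by auto
  show finT: "finite ?T"
  proof (rule finite_imageD[OF _ inj])
    have "(*) p ` ?T \<subseteq> A" by (auto simp: cofactors_def)
    then show "finite ((*) p ` ?T)" using fin by (rule finite_subset)
  qed
  show "0 \<notin> ?T" using pos by (auto simp: cofactors_def)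
  have split: "sum f A = sum f ?R + (\<Sum>k\<in>?T. f (p * k))" for f :: "nat \<Rightarrow> 'b::comm_monoid_add"
  proof -
    have "sum f A = sum f (?R \<union> (*) p ` ?T)" using A_eq by simp
    also have "\<dots> = sum f ?R + sum f ((*) p ` ?T)"
      using fin finT disj by (intro sum.union_disjoint) auto
    also have "sum f ((*) p ` ?T) = (\<Sum>k\<in>?T. f (p * k))"
      by (simp add: sum.reindex[OF inj])
    finally show ?thesis .
  qed
  show "n = \<Sum>?R + p * \<Sum>?T"
    using split[of "\<lambda>a. a"] sum by (simp add: sum_distrib_left)
  show "\<alpha> = (\<Sum>a\<in>?R. 1 / of_nat a) + (\<Sum>k\<in>?T. 1 / of_nat k) / of_nat p"
    using split[of "\<lambda>a. 1 / of_nat a :: rat"] val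
    by (simp add: sum_divide_distrib mult.commute)
qed

text \<open>
  The factor 12 is the least common multiple of 1, 2, 3, 4 and makes the reciprocal sums
  integral. The seven values are distinct, so twelve times the reciprocal sum determines the
  sum of the set.
\<close>

lemma light_sets:
  fixes T :: "nat set"
  assumes "finite T" "0 \<notin> T" "\<Sum>T \<le> 4"
  shows "(\<Sum>T, \<Sum>k\<in>T. 12 div k) \<in> {(0, 0), (1, 12), (2, 6), (3, 4), (4, 3), (3, 18), (4, 16)}"
    and "(\<Sum>k\<in>T. 1 / of_nat k) = (of_nat (\<Sum>k\<in>T. 12 div k) / 12 :: rat)"
proof -
  have "k \<in> {1, 2, 3, 4}" if "k \<in> T" for k
  proof -
    have "k \<le> \<Sum>T" using that assms(1) by (intro member_le_sum) auto
    moreover have "k \<noteq> 0" using that assms(2) by (cases "k = 0") auto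
    moreover note assms(3)
    ultimately show ?thesis by (simp, linarith)
  qed
  then have "T \<in> Pow {1, 2, 3, 4}" by blast
  then have T: "T \<in> {{}, {1}, {2}, {3}, {4}, {1, 2}, {1, 3}, {1, 4}, {2, 3}, {2, 4}, {3, 4},
      {1, 2, 3}, {1, 2, 4}, {1, 3, 4}, {2, 3, 4}, {1, 2, 3, 4}}"
    by (simp add: Pow_insert image_insert) (elim disjE; simp add: insert_commute)
  show "(\<Sum>T, \<Sum>k\<in>T. 12 div k) \<in> {(0, 0), (1, 12), (2, 6), (3, 4), (4, 3), (3, 18), (4, 16)}"
    using T assms(3) by (elim insertE emptyE) simp_all
  show "(\<Sum>k\<in>T. 1 / of_nat k) = (of_nat (\<Sum>k\<in>T. 12 div k) / 12 :: rat)"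
    using T by (elim insertE emptyE) simp_all
qed

lemma integral_reciprocal_sum:
  assumes "finite R" "\<forall>a\<in>R. 0 < a \<and> a dvd M"
  obtains I :: int where "of_nat M * (\<Sum>a\<in>R. 1 / of_nat a :: rat) = of_int I"
proof
  have "of_nat M * (1 / of_nat a) = (of_nat (M div a) :: rat)" if "a \<in> R" for a
  proof -
    have "M = a * (M div a)" "0 < a" using assms(2) that by auto
    then have "(of_nat M :: rat) = of_nat a * of_nat (M div a)"
      by (subst of_nat_mult[symmetric]) simp
    then show ?thesis using \<open>0 < a\<close> by simp
  qed
  then have "of_nat M * (\<Sum>a\<in>R. 1 / of_nat a) = (\<Sum>a\<in>R. of_nat (M div a) :: rat)"
    unfolding sum_distrib_left by (rule sum.cong[OF refl])
  then show "of_nat M * (\<Sum>a\<in>R. 1 / of_nat a :: rat) = of_int (\<Sum>a\<in>R. int (M div a))"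
    by simp
qed

text \<open>
  Both partitions have the same reciprocal sum, so clearing denominators by \<open>12 p M\<close>, with \<open>M\<close>
  the product of the parts prime to \<open>p\<close>, shows that twelve times the reciprocal sums of the
  two sets of cofactors are congruent modulo \<open>p\<close>. By \<open>light_sets\<close> both are among 0, 3, 4, 6,
  12, 16, 18. No two of these differ by 17, and only 0 and 18 differ by 18, which is not
  prime; so they are equal. The bounds 84 < 17 * 5 on \<open>n\<close> and 17 on \<open>p\<close> come from here.
\<close>

lemma cofactors_forced:
  assumes p: "prime p" "17 \<le> p"
    and A: "alpha_partition \<alpha> n A" "n \<le> 84" and B: "alpha_partition \<alpha> m B" "m \<le> 84"
  shows "\<Sum>(cofactors p A) = \<Sum>(cofactors p B)"
    and "(\<Sum>k\<in>cofactors p A. 1 / of_nat k) = (\<Sum>k\<in>cofactors p B. 1 / of_nat k :: rat)"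
proof -
  let ?S = "cofactors p A" and ?T = "cofactors p B"
  let ?R = "\<lambda>A. {a \<in> A. \<not> p dvd a}"
  define c where "c = (\<Sum>k\<in>?S. 12 div k)"
  define d where "d = (\<Sum>k\<in>?T. 12 div k)"
  \<comment> \<open>a common denominator of the parts prime to \<open>p\<close> that is itself prime to \<open>p\<close>\<close>
  define M where "M = \<Prod>(?R A \<union> ?R B)"
  have p0: "0 < p" using p by simp
  note sA = partition_split[OF A(1) p0] and sB = partition_split[OF B(1) p0]
  have light: "\<Sum>(cofactors p C) \<le> 4" if "k \<le> 84" "k = r + p * \<Sum>(cofactors p C)" for C k r
  proof (rule ccontr)
    assume "\<not> ?thesis"
    then have "17 * 5 \<le> p * \<Sum>(cofactors p C)" using p(2) by (intro mult_le_mono) auto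
    then show False using that by linarith
  qed
  note lA = light_sets[OF sA(1,2) light[OF A(2) sA(3)]]
    and lB = light_sets[OF sB(1,2) light[OF B(2) sB(3)]]
  have fin: "finite (?R A)" "finite (?R B)"
    and pos: "\<forall>a\<in>?R A. 0 < a" "\<forall>a\<in>?R B. 0 < a"
    using A(1) B(1) by (auto simp: alpha_partition_def)
  have dvdM: "a dvd M" if "a \<in> ?R A \<union> ?R B" for a
    unfolding M_def using fin that by (intro dvd_prodI) auto
  have "\<not> p dvd M"
    unfolding M_def using p(1) fin by (subst prime_dvd_prod_iff) auto
  obtain I where I: "of_nat M * (\<Sum>a\<in>?R A. 1 / of_nat a :: rat) = of_int I"
    using integral_reciprocal_sum[OF fin(1), of M] pos(1) dvdM by blast
  obtain J where J: "of_nat M * (\<Sum>a\<in>?R B. 1 / of_nat a :: rat) = of_int J"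
    using integral_reciprocal_sum[OF fin(2), of M] pos(2) dvdM by blast
  have eqA: "12 * of_nat p * of_nat M * \<alpha> = of_int (12 * int p * I + int M * int c)"
  proof -
    have "12 * of_nat p * of_nat M * \<alpha> = 12 * of_nat p * (of_nat M * (\<Sum>a\<in>?R A. 1 / of_nat a))
        + of_nat M * (12 * (\<Sum>k\<in>?S. 1 / of_nat k))"
      using p0 by (subst sA(4)) (simp add: algebra_simps)
    then show ?thesis unfolding I lA(2) c_def by simp
  qed
  have eqB: "12 * of_nat p * of_nat M * \<alpha> = of_int (12 * int p * J + int M * int d)"
  proof -
    have "12 * of_nat p * of_nat M * \<alpha> = 12 * of_nat p * (of_nat M * (\<Sum>a\<in>?R B. 1 / of_nat a))
        + of_nat M * (12 * (\<Sum>k\<in>?T. 1 / of_nat k))"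
      using p0 by (subst sB(4)) (simp add: algebra_simps)
    then show ?thesis unfolding J lB(2) d_def by simp
  qed
  have "12 * int p * I + int M * int c = 12 * int p * J + int M * int d"
    using trans[OF eqA[symmetric] eqB] by (simp only: of_int_eq_iff)
  then have "int M * (int c - int d) = int p * (12 * (J - I))"
    by (simp add: algebra_simps)
  then have "int p dvd int M * (int c - int d)" by simp
  moreover have "prime (int p)" using p(1) by simp
  ultimately have dvd: "int p dvd int c - int d"
    using \<open>\<not> p dvd M\<close> by (simp add: prime_dvd_mult_iff)
  have cd: "(\<Sum>?S, c) \<in> {(0, 0), (1, 12), (2, 6), (3, 4), (4, 3), (3, 18), (4, 16)}"
    "(\<Sum>?T, d) \<in> {(0, 0), (1, 12), (2, 6), (3, 4), (4, 3), (3, 18), (4, 16)}"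
    using lA(1) lB(1) by (simp_all add: c_def d_def)
  have "c = d"
  proof (rule ccontr)
    assume "c \<noteq> d"
    have "p \<noteq> 18"
    proof
      assume "p = 18"
      moreover have "\<not> prime (18 :: nat)" by simp
      ultimately show False using p(1) by simp
    qed
    have le: "c \<le> 18" "d \<le> 18" using cd by auto
    obtain t where t: "int c - int d = int p * t" using dvd by auto
    have "\<bar>int p * t\<bar> \<le> 18" using le t by linarith
    moreover have "17 * \<bar>t\<bar> \<le> int p * \<bar>t\<bar>" using p(2) by (intro mult_right_mono) auto
    ultimately have "\<bar>t\<bar> \<le> 1" by (simp add: abs_mult)
    moreover have "t \<noteq> 0" using t \<open>c \<noteq> d\<close> by auto
    ultimately have "t = 1 \<or> t = -1" by linarith
    then have "\<bar>int c - int d\<bar> = int p" using t by auto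
    then have "\<bar>int c - int d\<bar> = 17" using le \<open>p \<noteq> 18\<close> p(2) by linarith
    then show False using cd by auto
  qed
  then show "\<Sum>?S = \<Sum>?T" using cd by auto
  show "(\<Sum>k\<in>?S. 1 / of_nat k) = (\<Sum>k\<in>?T. 1 / of_nat k :: rat)"
    using lA(2) lB(2) \<open>c = d\<close> unfolding c_def d_def by simp
qed

text \<open>
  All partitions of the window have the same nonempty set of cofactors of \<open>p\<close>. Without the
  multiples of \<open>p\<close> they become partitions of the numbers in a window that starts at least 17
  lower, hence at \<open>69 - 17 = 52\<close> or below, and still have a common reciprocal sum.
\<close>

lemma no_large_prime_divisor:
  assumes IH: "\<forall>m<a. m \<le> 52 \<longrightarrow> blocked m (m + 5)" and ab: "a + 5 \<le> b" "b \<le> 84" "a \<le> 69"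
    and A: "\<forall>n\<in>{a..b}. alpha_partition \<alpha> n (A n)"
    and p: "prime p" "17 \<le> p" and n: "n \<in> {a..b}" and k: "k \<in> A n"
  shows "\<not> p dvd k"
proof
  assume "p dvd k"
  have p0: "0 < p" using p by simp
  define t where "t = \<Sum>(cofactors p (A a))"
  define c where "c = (\<Sum>k\<in>cofactors p (A a). 1 / of_nat k :: rat)"
  have a: "alpha_partition \<alpha> a (A a)" "a \<le> 84" using A ab by auto
  have forced: "\<Sum>(cofactors p (A i)) = t" "(\<Sum>k\<in>cofactors p (A i). 1 / of_nat k) = c"
    if i: "i \<in> {a..b}" for i
  proof -
    have "alpha_partition \<alpha> i (A i)" "i \<le> 84" using A ab(2) i by auto
    from cofactors_forced[OF p this a]
    show "\<Sum>(cofactors p (A i)) = t" "(\<Sum>k\<in>cofactors p (A i). 1 / of_nat k) = c"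
      unfolding t_def c_def .
  qed
  obtain j where j: "k = p * j" using \<open>p dvd k\<close> ..
  then have jn: "j \<in> cofactors p (A n)" using k by (simp add: cofactors_def)
  have An: "alpha_partition \<alpha> n (A n)" using A n by blast
  have "j \<le> t"
    unfolding forced(1)[OF n, symmetric]
    using jn partition_split(1)[OF An p0] by (intro member_le_sum) auto
  moreover have "j \<noteq> 0" using jn partition_split(2)[OF An p0] by metis
  ultimately have "t \<noteq> 0" by simp
  have pt: "p * t \<le> a" using partition_split(3)[OF a(1) p0] t_def by simp
  have "17 * 1 \<le> p * t" using p(2) \<open>t \<noteq> 0\<close> by (intro mult_le_mono) auto
  define m where "m = a - p * t"
  have "\<exists>B. alpha_partition (\<alpha> - c / of_nat p) i B" if i: "i \<in> {m..m + 5}" for i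
  proof -
    let ?i = "i + p * t"
    let ?R = "{k \<in> A ?i. \<not> p dvd k}"
    have i': "?i \<in> {a..b}" using i pt ab(1) by (auto simp: m_def)
    then have Ai: "alpha_partition \<alpha> ?i (A ?i)" using A by blast
    note s = partition_split(3,4)[OF Ai p0]
    have "\<Sum>?R = i" using s(1) forced(1)[OF i'] by simp
    moreover have "(\<Sum>k\<in>?R. 1 / of_nat k) = \<alpha> - c / of_nat p"
      using s(2) forced(2)[OF i'] by simp
    moreover have "finite ?R" "\<forall>k\<in>?R. 0 < k" using Ai by (auto simp: alpha_partition_def)
    ultimately show ?thesis unfolding alpha_partition_def by blast
  qed
  then have "\<not> blocked m (m + 5)" unfolding blocked_def by blast
  moreover have "m < a" "m \<le> 52" using \<open>17 * 1 \<le> p * t\<close> pt ab(3) by (auto simp: m_def)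
  ultimately show False using IH by blast
qed

section \<open>The search by prime levels\<close>

text \<open>
  A level removes one prime factor from the common denominator \<open>64 * 27 * 25 * 49 * 11 * 13\<close>
  of the available parts. Prime powers come in decreasing order, such as \<open>P49\<close> before \<open>P7\<close>:
  once the multiples of 49 are decided, the remaining parts divide the denominator with one
  factor 7 less.
\<close>

datatype level = P13 | P11 | P49 | P7 | P25 | P5 | P27 | P9 | P3

fun base :: "level \<Rightarrow> int" where
  "base P13 = 13" | "base P11 = 11" | "base P49 = 7" | "base P7 = 7" | "base P25 = 5" |
  "base P5 = 5" | "base P27 = 3" | "base P9 = 3" | "base P3 = 3"

text \<open>
  An entry \<open>(m, q, r)\<close> stands for the part \<open>m\<close>, whose scaled reciprocal, namely the
  denominator at this level divided by \<open>m\<close>, is \<open>q * base l + r\<close>; this is verified in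
  \<open>valid_levels\<close>.
\<close>

fun weights :: "level \<Rightarrow> (int \<times> int \<times> int) list" where
  "weights P13 = [(78, 298523, 1), (65, 358227, 9), (52, 447784, 8),
     (39, 597046, 2), (26, 895569, 3), (13, 1791138, 6)]" |
  "weights P11 = [(77, 27490, 10), (66, 32072, 8), (55, 38487, 3), (44, 48109, 1),
     (33, 64145, 5), (22, 96218, 2), (11, 192436, 4)]" |
  "weights P49 = [(49, 6171, 3)]" |
  "weights P7 = [(70, 617, 1), (63, 685, 5), (56, 771, 3), (42, 1028, 4), (35, 1234, 2),
     (28, 1542, 6), (21, 2057, 1), (14, 3085, 5), (7, 6171, 3)]" |
  "weights P25 = [(75, 115, 1), (50, 172, 4), (25, 345, 3)]" |
  "weights P5 = [(60, 28, 4), (45, 38, 2), (40, 43, 1), (30, 57, 3),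
     (20, 86, 2), (15, 115, 1), (10, 172, 4), (5, 345, 3)]" |
  "weights P27 = [(54, 10, 2), (27, 21, 1)]" |
  "weights P9 = [(72, 2, 2), (36, 5, 1), (18, 10, 2), (9, 21, 1)]" |
  "weights P3 = [(48, 1, 1), (24, 2, 2), (12, 5, 1), (6, 10, 2), (3, 21, 1)]"

definition levels :: "level list" where
  "levels = [P13, P11, P49, P7, P25, P5, P27, P9, P3]"

text \<open>
  Options \<open>(s, v)\<close> consist of a sum \<open>s\<close> of parts and their scaled reciprocal sum \<open>v\<close>. While
  the parts of a level with base \<open>d\<close> are added, \<open>v\<close> is kept as quotient and remainder by \<open>d\<close>,
  so that the residue classes can be read off without further divisions. All functions of the
  search are first-order recursions, which rewriting evaluates without going under binders.
\<close>

fun digits :: "int \<Rightarrow> (int \<times> int) list \<Rightarrow> (int \<times> int \<times> int) list" where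
  "digits d [] = []" |
  "digits d ((s, v) # Q) = (s, v div d, v mod d) # digits d Q"

fun with_carry :: "int \<Rightarrow> int \<Rightarrow> int \<Rightarrow> int \<Rightarrow> int \<times> int \<times> int" where
  "with_carry d s q r = (if r < d then (s, q, r) else (s, q + 1, r - d))"

text \<open>
  The bound \<open>c\<close> is the last number of the window minus \<open>m\<close>: options with a larger sum cannot
  take the part \<open>m\<close>.
\<close>

fun extend :: "int \<Rightarrow> int \<Rightarrow> int \<times> int \<times> int \<Rightarrow> (int \<times> int \<times> int) list \<Rightarrow> (int \<times> int \<times> int) list" where
  "extend d c w [] = []" |
  "extend d c (m, q', r') ((s, q, r) # Q) =
     (if s \<le> c
      then (s, q, r) # with_carry d (s + m) (q + q') (r + r') # extend d c (m, q', r') Q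
      else (s, q, r) # extend d c (m, q', r') Q)"

fun extend_all :: "int \<Rightarrow> int \<Rightarrow> (int \<times> int \<times> int) list \<Rightarrow> (int \<times> int \<times> int) list \<Rightarrow> (int \<times> int \<times> int) list" where
  "extend_all d b [] Q = Q" |
  "extend_all d b ((m, w) # ws) Q = extend_all d b ws (extend d (b - m) (m, w) Q)"

text \<open>
  The residue is common to a class; dropping it and keeping the quotient replaces the unknown
  \<open>x\<close> by \<open>(x - k) / d\<close> and passes to the denominator of the next level.
\<close>

fun residue_class :: "int \<Rightarrow> (int \<times> int \<times> int) list \<Rightarrow> (int \<times> int) list" where
  "residue_class k [] = []" |
  "residue_class k ((s, q, r) # Q) =
     (if r = k then (s, q) # residue_class k Q else residue_class k Q)"

fun residue_classes :: "int list \<Rightarrow> (int \<times> int \<times> int) list \<Rightarrow> (int \<times> int) list list" where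
  "residue_classes [] Q = []" |
  "residue_classes (k # ks) Q = residue_class k Q # residue_classes ks Q"

fun bit_reversal :: "int list \<Rightarrow> num \<Rightarrow> int" where
  "bit_reversal [] k = 0" |
  "bit_reversal (w # ws) num.One = w" |
  "bit_reversal (w # ws) (num.Bit0 k) = bit_reversal ws k" |
  "bit_reversal (w # ws) (num.Bit1 k) = w + bit_reversal ws k"

text \<open>
  For \<open>r \<le> 127\<close>, this is 64 times the reciprocal sum of the set of powers of two with sum \<open>r\<close>.
  The bit of weight \<open>2 ^ i\<close> in \<open>r\<close> contributes \<open>64 / 2 ^ i\<close>, which is why the weights are read
  in reverse.
\<close>

definition power2_value :: "int \<Rightarrow> int" where
  "power2_value r =
     (if r \<le> 0 then 0 else bit_reversal [64, 32, 16, 8, 4, 2, 1] (num_of_nat (nat r)))"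

text \<open>
  Evaluation works on the constructor \<open>Int.Pos\<close>, whose argument is the binary numeral itself.
\<close>

lemma power2_value_code [code]:
  "power2_value 0 = 0"
  "power2_value (Int.Pos k) = bit_reversal [64, 32, 16, 8, 4, 2, 1] k"
proof -
  have "num_of_nat (numeral k) = k"
    by (metis nat_of_num_inverse nat_of_num_numeral)
  then show "power2_value 0 = 0"
    and "power2_value (Int.Pos k) = bit_reversal [64, 32, 16, 8, 4, 2, 1] k"
    by (simp_all add: power2_value_def)
qed

fun completions :: "int \<Rightarrow> (int \<times> int) list \<Rightarrow> int list" where
  "completions n [] = []" |
  "completions n ((s, v) # Q) =
     (if s \<le> n then (v + power2_value (n - s)) # completions n Q else completions n Q)"

fun member :: "int \<Rightarrow> int list \<Rightarrow> bool" where
  "member x [] = False" |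
  "member x (y # ys) = (if x = y then True else member x ys)"

fun common :: "int list \<Rightarrow> int list \<Rightarrow> int list" where
  "common [] ys = []" |
  "common (x # xs) ys = (if member x ys then x # common xs ys else common xs ys)"

text \<open>
  The list holds the values still possible after the numbers up to \<open>n\<close>; the \<open>k\<close> numbers after
  \<open>n\<close> must eliminate all of them.
\<close>

fun die_out :: "(int \<times> int) list \<Rightarrow> int \<Rightarrow> nat \<Rightarrow> int list \<Rightarrow> bool" where
  "die_out Q n k [] = True" |
  "die_out Q n 0 (x # xs) = False" |
  "die_out Q n (Suc k) (x # xs) = die_out Q (n + 1) k (common (x # xs) (completions (n + 1) Q))"

fun early_sums :: "int \<Rightarrow> (int \<times> int) list \<Rightarrow> int list" where
  "early_sums c [] = []" |
  "early_sums c ((s, v) # Q) = (if s \<le> c then s # early_sums c Q else early_sums c Q)"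

fun all_above :: "int \<Rightarrow> int list \<Rightarrow> bool" where
  "all_above a [] = True" |
  "all_above a (s # ss) = (if s \<le> a then False else all_above a ss)"

text \<open>
  Applied to the sums of those options that can occur in partitions of \<open>a, \<dots>, a + 5\<close>. A class
  is settled if none of them serves \<open>a\<close> itself, or if there is only one, with positive sum,
  and the window reduced by this sum \<open>s\<close> starts at \<open>a - s \<le> 52\<close>, where windows of length six
  are blocked by induction.
\<close>

fun settled :: "int \<Rightarrow> int list \<Rightarrow> bool" where
  "settled a [] = True" |
  "settled a [s] = (a < s \<or> 0 < s \<and> a - s \<le> 52)" |
  "settled a (s # t # ss) = all_above a (s # t # ss)"

text \<open>
  The classes of a level are alternatives for the one unknown value, so each of them must fail
  separately.
\<close>

fun search_fails :: "int \<Rightarrow> int \<Rightarrow> level list \<Rightarrow> (int \<times> int) list \<Rightarrow> bool"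
  and searches_fail :: "int \<Rightarrow> int \<Rightarrow> level list \<Rightarrow> (int \<times> int) list list \<Rightarrow> bool"
where
  "search_fails a b [] Q = die_out Q a (nat (b - a)) (completions a Q)" |
  "search_fails a b (l # ls) Q =
     searches_fail a b ls (residue_classes [0..base l - 1]
       (extend_all (base l) b (weights l) (digits (base l) Q)))" |
  "searches_fail a b ls [] = True" |
  "searches_fail a b ls (Q # Qs) =
     ((if settled a (early_sums (a + 5) Q) then True else search_fails a b ls Q) \<and> searches_fail a b ls Qs)"

fun windows_fail :: "int list \<Rightarrow> bool" where
  "windows_fail [] = True" |
  "windows_fail (m # ms) = (search_fails m (m + 5) levels [(0, 0)] \<and> windows_fail ms)"

section \<open>Soundness of one level\<close>

text \<open>
  The constraint that the search refutes for all \<open>n\<close> of a window simultaneously: some option,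
  completed by parts from \<open>U\<close>, has sum \<open>n\<close> and scaled reciprocal sum \<open>x\<close>. The unknown \<open>x\<close> is
  the same for all \<open>n\<close>.
\<close>

definition solves :: "int list \<Rightarrow> int \<Rightarrow> (int \<times> int) list \<Rightarrow> rat \<Rightarrow> nat \<Rightarrow> bool" where
  "solves U L Q x n \<longleftrightarrow>
     (\<exists>s v A. (s, v) \<in> set Q \<and> finite A \<and> int ` A \<subseteq> set U \<and> s + int (\<Sum>A) = int n \<and>
        x = of_int v + (\<Sum>a\<in>A. of_int L / of_nat a))"

lemma solvesI:
  assumes "(s, v) \<in> set Q" "finite A" "int ` A \<subseteq> set U" "s + int (\<Sum>A) = int n"
    and "x = of_int v + (\<Sum>a\<in>A. of_int L / of_nat a)"
  shows "solves U L Q x n"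
  unfolding solves_def using assms by blast

definition undigit :: "int \<Rightarrow> int \<times> int \<times> int \<Rightarrow> int \<times> int" where
  "undigit d = (\<lambda>(s, q, r). (s, q * d + r))"

definition reduced :: "int \<Rightarrow> (int \<times> int \<times> int) list \<Rightarrow> bool" where
  "reduced d Q \<longleftrightarrow> (\<forall>(s, q, r)\<in>set Q. 0 \<le> r \<and> r < d)"

lemma undigit_digits: "map (undigit d) (digits d Q) = Q"
  by (induction d Q rule: digits.induct) (auto simp: undigit_def)

lemma reduced_digits: "0 < d \<Longrightarrow> reduced d (digits d Q)"
  by (induction d Q rule: digits.induct) (auto simp: reduced_def)

lemma reduced_extend:
  "reduced d Q \<Longrightarrow> 0 \<le> r' \<Longrightarrow> r' < d \<Longrightarrow> reduced d (extend d c (m, q', r') Q)"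
  by (induction Q) (auto simp: reduced_def split: if_splits)

lemma extend_keeps:
  "p \<in> undigit d ` set Q \<Longrightarrow> p \<in> undigit d ` set (extend d c (m, q', r') Q)"
proof -
  have "set Q \<subseteq> set (extend d c (m, q', r') Q)"
    by (induction Q) auto
  then show "p \<in> undigit d ` set Q \<Longrightarrow> ?thesis" by blast
qed

lemma extend_adds:
  "(s, v) \<in> undigit d ` set Q \<Longrightarrow> s \<le> c \<Longrightarrow>
   (s + m, v + (q' * d + r')) \<in> undigit d ` set (extend d c (m, q', r') Q)"
proof (induction Q)
  case (Cons p Q)
  obtain t q r where p: "p = (t, q, r)" by (cases p)
  show ?case
  proof (cases "(s, v) = undigit d p")
    case True
    then show ?thesis
      using Cons.prems(2) by (auto simp: p undigit_def algebra_simps)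
  next
    case False
    then have "(s, v) \<in> undigit d ` set Q"
      using Cons.prems(1) by auto
    then show ?thesis
      using Cons.IH Cons.prems(2) by (auto simp: p)
  qed
qed simp

lemma solves_extend:
  assumes sol: "solves (m # U) L (map (undigit d) Q) x n"
    and m: "m \<notin> set U" "0 < m" "m * (q' * d + r') = L" and n: "int n \<le> b"
  shows "solves U L (map (undigit d) (extend d (b - m) (m, q', r') Q)) x n"
proof -
  obtain s v A where Q: "(s, v) \<in> undigit d ` set Q"
    and A: "finite A" "int ` A \<subseteq> set (m # U)" "s + int (\<Sum>A) = int n"
    and x: "x = of_int v + (\<Sum>a\<in>A. of_int L / of_nat a)"
    using sol by (auto simp: solves_def)
  show ?thesis
  proof (cases "m \<in> int ` A")
    case False
    then have "int ` A \<subseteq> set U" using A by auto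
    then show ?thesis
      using extend_keeps[OF Q] A x by (intro solvesI[of s v]) auto
  next
    case True
    then obtain k where k: "k \<in> A" "m = int k" by auto
    let ?B = "A - {k}"
    have sum: "\<Sum>A = k + \<Sum>?B"
      using k(1) A(1) by (simp add: sum.remove)
    then have si: "int (\<Sum>A) = m + int (\<Sum>?B)"
      using k(2) by (simp only: of_nat_add)
    then have "s \<le> b - m" using A(3) n by linarith
    then have Q': "(s + m, v + (q' * d + r')) \<in> undigit d ` set (extend d (b - m) (m, q', r') Q)"
      by (rule extend_adds[OF Q])
    have "int k * (q' * d + r') = L" using m(3) k(2) by simp
    then have "(of_int L :: rat) = of_nat k * of_int (q' * d + r')"
      by (metis of_int_mult of_int_of_nat_eq)
    then have "(of_int L :: rat) / of_nat k = of_int (q' * d + r')"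
      using m(2) k(2) by simp
    then have x': "x = of_int (v + (q' * d + r')) + (\<Sum>a\<in>?B. of_int L / of_nat a)"
      using x k(1) A(1) by (simp add: sum.remove)
    have "int ` ?B \<subseteq> set U" using A(2) k(2) by auto
    moreover have "s + m + int (\<Sum>?B) = int n" using A(3) si by linarith
    ultimately show ?thesis
      using Q' x' A(1) by (intro solvesI[of "s + m" "v + (q' * d + r')"]) auto
  qed
qed

fun valid_weights :: "int \<Rightarrow> int \<Rightarrow> (int \<times> int \<times> int) list \<Rightarrow> int list \<Rightarrow> bool" where
  "valid_weights d L [] U = True" |
  "valid_weights d L ((m, q, r) # ws) U =
     (0 < m \<and> m * (q * d + r) = L \<and> 0 \<le> r \<and> r < d \<and> m \<notin> set (map fst ws @ U) \<and>
      valid_weights d L ws U)"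

lemma solves_extend_all:
  assumes "solves (map fst ws @ U) L (map (undigit d) Q) x n"
    and "valid_weights d L ws U" and "int n \<le> b"
  shows "solves U L (map (undigit d) (extend_all d b ws Q)) x n"
  using assms
proof (induction ws arbitrary: Q)
  case (Cons w ws)
  obtain m q r where w: "w = (m, q, r)" by (cases w)
  have val: "0 < m" "m * (q * d + r) = L" "m \<notin> set (map fst ws @ U)" "valid_weights d L ws U"
    using Cons.prems(2) by (simp_all only: w valid_weights.simps simp_thms)
  have "solves (m # map fst ws @ U) L (map (undigit d) Q) x n"
    using Cons.prems(1) by (simp only: w list.map fst_conv append_Cons)
  then have "solves (map fst ws @ U) L (map (undigit d) (extend d (b - m) (m, q, r) Q)) x n"
    using val(3,1,2) Cons.prems(3) by (rule solves_extend)
  then have "solves U L (map (undigit d) (extend_all d b ws (extend d (b - m) (m, q, r) Q))) x n"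
    using val(4) Cons.prems(3) by (rule Cons.IH)
  then show ?case by (simp only: w extend_all.simps)
qed simp

lemma reduced_extend_all:
  "reduced d Q \<Longrightarrow> valid_weights d L ws U \<Longrightarrow> reduced d (extend_all d b ws Q)"
proof (induction ws arbitrary: Q)
  case (Cons w ws)
  obtain m q r where w: "w = (m, q, r)" by (cases w)
  have val: "0 \<le> r" "r < d" "valid_weights d L ws U"
    using Cons.prems(2) by (simp_all only: w valid_weights.simps simp_thms)
  have "reduced d (extend d (b - m) (m, q, r) Q)"
    using Cons.prems(1) val(1,2) by (rule reduced_extend)
  then have "reduced d (extend_all d b ws (extend d (b - m) (m, q, r) Q))"
    using val(3) by (rule Cons.IH)
  then show ?case by (simp only: w extend_all.simps)
qed simp

lemma set_residue_class: "set (residue_class k Q) = {(s, q). (s, q, k) \<in> set Q}"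
  by (induction k Q rule: residue_class.induct) auto

text \<open>
  The parts that are still available divide \<open>L\<close>, so with denominator \<open>d * L\<close> each contributes
  a multiple of \<open>d\<close>. Hence \<open>x\<close> is an integer whose residue modulo \<open>d\<close> is that of the option
  alone. The class is named by \<open>x\<close> and not by the option or by \<open>n\<close>, which is what lets one
  class serve the whole window.
\<close>

lemma solves_residue_class:
  assumes sol: "solves U (d * L) (map (undigit d) Q) x n"
    and Q: "reduced d Q" and U: "\<forall>u\<in>set U. 0 < u \<and> u dvd L" and d: "0 < d"
  shows "solves U L (residue_class (\<lfloor>x\<rfloor> mod d) Q) ((x - of_int (\<lfloor>x\<rfloor> mod d)) / of_int d) n"
proof -
  obtain s q r A where Qm: "(s, q, r) \<in> set Q"
    and A: "finite A" "int ` A \<subseteq> set U" "s + int (\<Sum>A) = int n"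
    and x: "x = of_int (q * d + r) + (\<Sum>a\<in>A. of_int (d * L) / of_nat a)"
    using sol by (auto simp: solves_def undigit_def)
  define S where "S = (\<Sum>a\<in>A. L div int a)"
  have div: "(of_int L :: rat) / of_nat a = of_int (L div int a)" if "a \<in> A" for a
  proof -
    have "int a \<in> set U" using that A(2) by auto
    then have "int a dvd L" "0 < a" using U by auto
    then have "L = int a * (L div int a)" by simp
    then have "(of_int L :: rat) = of_nat a * of_int (L div int a)"
      by (subst of_int_of_nat_eq[symmetric], subst of_int_mult[symmetric]) simp
    then show ?thesis using \<open>0 < a\<close> by simp
  qed
  have S: "(\<Sum>a\<in>A. of_int L / of_nat a) = (of_int S :: rat)"
    unfolding S_def of_int_sum by (rule sum.cong) (simp_all add: div)
  have "(\<Sum>a\<in>A. of_int (d * L) / of_nat a) = of_int d * (\<Sum>a\<in>A. of_int L / of_nat a :: rat)"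
    by (simp add: sum_distrib_left)
  then have x': "x = of_int ((q + S) * d + r)"
    using x S by (simp add: algebra_simps)
  have r: "0 \<le> r" "r < d" using Q Qm by (auto simp: reduced_def)
  then have mod: "\<lfloor>x\<rfloor> mod d = r"
    by (simp only: x' floor_of_int) (simp add: mod_pos_pos_trivial)
  have "(x - of_int r) / of_int d = of_int q + (\<Sum>a\<in>A. of_int L / of_nat a)"
    using d by (simp add: x' S)
  then show ?thesis
    unfolding mod solves_def set_residue_class using Qm A by blast
qed

fun denominator :: "level list \<Rightarrow> int" where
  "denominator [] = 64" |
  "denominator (l # ls) = base l * denominator ls"

fun pool :: "level list \<Rightarrow> int list" where
  "pool [] = [1, 2, 4, 8, 16, 32, 64]" |
  "pool (l # ls) = map fst (weights l) @ pool ls"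

text \<open>
  Each part is new, its weight is correct, and the parts left for later levels divide the
  later denominator: the hypotheses under which a level loses no solution.
\<close>

fun valid :: "level list \<Rightarrow> bool" where
  "valid [] = True" |
  "valid (l # ls) =
     (0 < base l \<and> valid_weights (base l) (base l * denominator ls) (weights l) (pool ls) \<and>
      (\<forall>u\<in>set (pool ls). u dvd denominator ls) \<and> valid ls)"

lemma valid_levels: "valid levels"
  by code_simp

lemma valid_weights_pos: "valid_weights d L ws U \<Longrightarrow> \<forall>w\<in>set ws. 0 < fst w"
  by (induction d L ws U rule: valid_weights.induct) auto

lemma pool_pos: "valid ls \<Longrightarrow> u \<in> set (pool ls) \<Longrightarrow> 0 < u"
proof (induction ls)
  case (Cons l ls)
  then show ?case using valid_weights_pos by fastforce
qed auto

lemma denominator_pos: "valid ls \<Longrightarrow> 0 < denominator ls"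
  by (induction ls) auto

lemma in_residue_classes: "k \<in> set ks \<Longrightarrow> residue_class k Q \<in> set (residue_classes ks Q)"
  by (induction ks) auto

lemma solves_level:
  assumes v: "valid (l # ls)"
    and sol: "\<forall>n\<in>{a..b}. solves (pool (l # ls)) (denominator (l # ls)) Q x n"
  obtains Q' y where
    "Q' \<in> set (residue_classes [0..base l - 1]
       (extend_all (base l) (int b) (weights l) (digits (base l) Q)))"
    "\<forall>n\<in>{a..b}. solves (pool ls) (denominator ls) Q' y n"
proof -
  let ?d = "base l"
  let ?R = "extend_all ?d (int b) (weights l) (digits ?d Q)"
  let ?k = "\<lfloor>x\<rfloor> mod ?d"
  have d: "0 < ?d" using v by simp
  have R: "reduced ?d ?R"
    using v by (intro reduced_extend_all reduced_digits) auto
  have "solves (pool ls) (denominator ls) (residue_class ?k ?R) ((x - of_int ?k) / of_int ?d) n"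
    if n: "n \<in> {a..b}" for n
  proof (rule solves_residue_class[OF _ R _ d])
    show "solves (pool ls) (?d * denominator ls) (map (undigit ?d) ?R) x n"
      using sol n v by (intro solves_extend_all) (auto simp: undigit_digits)
    show "\<forall>u\<in>set (pool ls). 0 < u \<and> u dvd denominator ls"
      using v pool_pos by auto
  qed
  moreover have "residue_class ?k ?R \<in> set (residue_classes [0..?d - 1] ?R)"
    using d by (intro in_residue_classes) auto
  ultimately show thesis using that by blast
qed

section \<open>Powers of two\<close>

text \<open>
  Halving the parts other than 1 shifts the binary expansion of the sum by one place and
  doubles the reciprocals; whether 1 is a part is the last bit of the sum.
\<close>

lemma power2_split:
  fixes A :: "nat set" and c :: rat
  assumes A: "finite A" "\<forall>a\<in>A. \<exists>i. a = 2 ^ i"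
  obtains B where "finite B" "\<forall>b\<in>B. \<exists>i. b = 2 ^ i" "\<Sum>A = of_bool (1 \<in> A) + 2 * \<Sum>B"
    "(\<Sum>a\<in>A. c / of_nat a) = of_bool (1 \<in> A) * c + (\<Sum>b\<in>B. c / 2 / of_nat b)"
proof -
  define B where "B = (\<lambda>a. a div 2) ` (A - {1})"
  have ev: "\<exists>i. a = 2 * 2 ^ i" if "a \<in> A - {1}" for a
  proof -
    have "a \<in> A" using that by simp
    with A(2) have "\<exists>i. a = 2 ^ i" by (rule bspec)
    then obtain i where "a = 2 ^ i" ..
    then show ?thesis using that by (cases i) auto
  qed
  have half: "2 * (a div 2) = a" if "a \<in> A - {1}" for a
    using ev[OF that] by (elim exE) simp
  have inj: "inj_on (\<lambda>a. a div 2) (A - {1})"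
    by (rule inj_on_inverseI) (rule half)
  \<comment> \<open>used both for the parts and for their reciprocals\<close>
  have rem: "sum f A = of_bool (1 \<in> A) * f 1 + sum f (A - {1})" for f :: "nat \<Rightarrow> 'b::semiring_1"
    using sum.remove[OF A(1), of 1 f] by (cases "1 \<in> A") simp_all
  have "\<Sum>(A - {1}) = 2 * \<Sum>B"
    unfolding B_def sum.reindex[OF inj] sum_distrib_left
    by (rule sum.cong) (simp_all only: half o_apply id_apply)
  then have 1: "\<Sum>A = of_bool (1 \<in> A) + 2 * \<Sum>B"
    using rem[of "\<lambda>a. a"] by simp
  have "(\<Sum>a\<in>A - {1}. c / of_nat a) = (\<Sum>b\<in>B. c / 2 / of_nat b)"
    unfolding B_def sum.reindex[OF inj]
  proof (rule sum.cong, rule refl)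
    fix a assume "a \<in> A - {1}"
    then have "(of_nat a :: rat) = of_nat (2 * (a div 2))"
      by (simp only: half)
    then have "(of_nat a :: rat) = 2 * of_nat (a div 2)"
      by (simp only: of_nat_mult of_nat_numeral)
    then show "c / of_nat a = ((\<lambda>b. c / 2 / of_nat b) \<circ> (\<lambda>a. a div 2)) a"
      by (simp only: o_apply divide_divide_eq_left)
  qed
  then have 2: "(\<Sum>a\<in>A. c / of_nat a) = of_bool (1 \<in> A) * c + (\<Sum>b\<in>B. c / 2 / of_nat b)"
    using rem[of "\<lambda>a. c / of_nat a"] by simp
  show thesis
  proof (rule that[of B, OF _ _ 1 2])
    show "finite B" using A(1) by (simp add: B_def)
    show "\<forall>b\<in>B. \<exists>i. b = 2 ^ i" using ev by (force simp: B_def)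
  qed
qed

lemma binary_step:
  fixes s t :: nat
  shows "1 = of_bool P + 2 * s \<Longrightarrow> P \<and> s = 0"
    and "2 * t = of_bool P + 2 * s \<Longrightarrow> \<not> P \<and> s = t"
    and "2 * t + 1 = of_bool P + 2 * s \<Longrightarrow> P \<and> s = t"
  by (cases P; simp only: of_bool_eq; presburger)+

lemma numeral_double:
  "numeral (num.Bit0 k) = 2 * (numeral k :: nat)"
  "numeral (num.Bit1 k) = 2 * (numeral k :: nat) + 1"
  unfolding mult_2 by (rule numeral_Bit0 numeral_Bit1)+

lemma bit_reversal_eq_sum:
  fixes A :: "nat set"
  assumes "finite A" "\<forall>a\<in>A. \<exists>i. a = 2 ^ i" "\<Sum>A = numeral k" "\<Sum>A < 2 ^ j"
  shows "of_int (bit_reversal (map (\<lambda>i. 2 ^ i) (rev [0..<j])) k) =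
    (\<Sum>a\<in>A. 2 ^ j / 2 / of_nat a :: rat)"
  using assms
proof (induction k arbitrary: A j)
  case One
  obtain i where j: "j = Suc i" using One.prems by (cases j) auto
  obtain B where B: "finite B" "\<forall>b\<in>B. \<exists>i. b = 2 ^ i" "\<Sum>A = of_bool (1 \<in> A) + 2 * \<Sum>B"
    "(\<Sum>a\<in>A. 2 ^ i / of_nat a :: rat) =
       of_bool (1 \<in> A) * 2 ^ i + (\<Sum>b\<in>B. 2 ^ i / 2 / of_nat b)"
    using One.prems(1,2) by (rule power2_split)
  have "1 = of_bool (1 \<in> A) + 2 * \<Sum>B" using One.prems(3) B(3) unfolding numeral_One by (rule trans[OF sym])
  then have "1 \<in> A \<and> \<Sum>B = 0" by (rule binary_step)
  moreover have "0 \<notin> B" using B(2) by auto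
  ultimately have "1 \<in> A" "B = {}" using B(1) by auto
  then show ?case using B(4) by (simp add: j)
next
  case (Bit0 k)
  obtain i where j: "j = Suc i" using Bit0.prems by (cases j) auto
  obtain B where B: "finite B" "\<forall>b\<in>B. \<exists>i. b = 2 ^ i" "\<Sum>A = of_bool (1 \<in> A) + 2 * \<Sum>B"
    "(\<Sum>a\<in>A. 2 ^ i / of_nat a :: rat) =
       of_bool (1 \<in> A) * 2 ^ i + (\<Sum>b\<in>B. 2 ^ i / 2 / of_nat b)"
    using Bit0.prems(1,2) by (rule power2_split)
  have "2 * numeral k = of_bool (1 \<in> A) + 2 * \<Sum>B"
    using trans[OF numeral_double(1)[symmetric] Bit0.prems(3)[symmetric]] B(3) by (rule trans)
  then have "1 \<notin> A \<and> \<Sum>B = numeral k" by (rule binary_step)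
  then have *: "1 \<notin> A" "\<Sum>B = numeral k" by blast+
  then have "\<Sum>B < 2 ^ i" using B(3) Bit0.prems(4) unfolding j power_Suc by linarith
  from Bit0.IH[OF B(1,2) *(2) this] show ?case using B(4) *(1) by (simp add: j)
next
  case (Bit1 k)
  obtain i where j: "j = Suc i" using Bit1.prems by (cases j) auto
  obtain B where B: "finite B" "\<forall>b\<in>B. \<exists>i. b = 2 ^ i" "\<Sum>A = of_bool (1 \<in> A) + 2 * \<Sum>B"
    "(\<Sum>a\<in>A. 2 ^ i / of_nat a :: rat) =
       of_bool (1 \<in> A) * 2 ^ i + (\<Sum>b\<in>B. 2 ^ i / 2 / of_nat b)"
    using Bit1.prems(1,2) by (rule power2_split)
  have "2 * numeral k + 1 = of_bool (1 \<in> A) + 2 * \<Sum>B"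
    using trans[OF numeral_double(2)[symmetric] Bit1.prems(3)[symmetric]] B(3) by (rule trans)
  then have "1 \<in> A \<and> \<Sum>B = numeral k" by (rule binary_step)
  then have *: "1 \<in> A" "\<Sum>B = numeral k" by blast+
  then have "\<Sum>B < 2 ^ i" using B(3) Bit1.prems(4) unfolding j power_Suc by linarith
  from Bit1.IH[OF B(1,2) *(2) this] show ?case using B(4) *(1) by (simp add: j)
qed

text \<open>
  Seven weights suffice, since distinct powers of two up to 64 add up to at most 127.
\<close>

lemma power2_value_eq_sum:
  fixes A :: "nat set"
  assumes "finite A" "int ` A \<subseteq> set (pool [])"
  shows "of_int (power2_value (int (\<Sum>A))) = (\<Sum>a\<in>A. 64 / of_nat a :: rat)"
proof (cases "\<Sum>A = 0")
  case True
  moreover have "0 \<notin> A" using assms(2) by auto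
  ultimately have "A = {}" using assms(1) by auto
  then show ?thesis by (simp add: power2_value_def)
next
  case False
  have "\<exists>i. a = 2 ^ i" if "a \<in> A" for a
  proof -
    have "int a \<in> {2 ^ 0, 2 ^ 1, 2 ^ 2, 2 ^ 3, 2 ^ 4, 2 ^ 5, 2 ^ 6}"
      using that assms(2) by auto
    then have "\<exists>i. int a = int (2 ^ i)" by (metis insert_iff empty_iff of_nat_numeral of_nat_power)
    then show ?thesis by (metis of_nat_eq_iff)
  qed
  moreover have "\<Sum>A = numeral (num_of_nat (\<Sum>A))"
    using False by (simp add: numeral_num_of_nat)
  moreover have "\<Sum>A < 2 ^ 7"
  proof -
    have "A \<subseteq> {1, 2, 4, 8, 16, 32, 64}" using assms(2) by auto
    then have "\<Sum>A \<le> \<Sum>{1, 2, 4, 8, 16, 32, 64 :: nat}" by (intro sum_mono2) auto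
    then show ?thesis by simp
  qed
  ultimately have *: "of_int (bit_reversal (map (\<lambda>i. 2 ^ i) (rev [0..<7])) (num_of_nat (\<Sum>A))) =
    (\<Sum>a\<in>A. 2 ^ 7 / 2 / of_nat a :: rat)"
    using assms(1) by (intro bit_reversal_eq_sum) auto
  have weights: "map (\<lambda>i. 2 ^ i) (rev [0..<7]) = [64, 32, 16, 8, 4, 2, 1 :: int]"
    by code_simp
  have "power2_value (int t) = bit_reversal [64, 32, 16, 8, 4, 2, 1] (num_of_nat t)"
    if "t \<noteq> 0" for t
    using that by (simp add: power2_value_def)
  then have "power2_value (int (\<Sum>A)) = bit_reversal [64, 32, 16, 8, 4, 2, 1] (num_of_nat (\<Sum>A))"
    using False .
  then show ?thesis using * weights by simp
qed

lemma in_completions: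
  "(s, v) \<in> set Q \<Longrightarrow> s \<le> n \<Longrightarrow> v + power2_value (n - s) \<in> set (completions n Q)"
  by (induction n Q rule: completions.induct) auto

lemma solves_completions:
  assumes "solves (pool []) (denominator []) Q x n"
  shows "x \<in> of_int ` set (completions (int n) Q)"
proof -
  obtain s v A where sv: "(s, v) \<in> set Q" and A: "finite A" "int ` A \<subseteq> set (pool [])"
    "s + int (\<Sum>A) = int n" and x: "x = of_int v + (\<Sum>a\<in>A. 64 / of_nat a)"
    using assms(1) by (auto simp: solves_def)
  have "x = of_int (v + power2_value (int (\<Sum>A)))"
    using power2_value_eq_sum[OF A(1,2)] x by simp
  moreover have "int (\<Sum>A) = int n - s" using A(3) by simp
  moreover have "s \<le> int n" using A(3) by linarith
  then have "v + power2_value (int n - s) \<in> set (completions (int n) Q)"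
    by (rule in_completions[OF sv])
  ultimately show ?thesis by (metis imageI)
qed

section \<open>Soundness of the search\<close>

lemma member_iff: "member x ys \<longleftrightarrow> x \<in> set ys"
  by (induction x ys rule: member.induct) auto

lemma set_common: "set (common xs ys) = set xs \<inter> set ys"
  by (induction xs ys rule: common.induct) (auto simp: member_iff)

lemma die_out_sound:
  "die_out Q n k xs \<Longrightarrow> y \<in> set xs \<Longrightarrow> \<exists>j\<in>{n<..n + int k}. y \<notin> set (completions j Q)"
proof (induction Q n k xs rule: die_out.induct)
  case (3 Q n k x xs)
  show ?case
  proof (cases "y \<in> set (completions (n + 1) Q)")
    case True
    then have "y \<in> set (common (x # xs) (completions (n + 1) Q))"
      using "3.prems"(2) unfolding set_common by blast
    then obtain j where "j\<in>{n + 1<..n + 1 + int k}" "y \<notin> set (completions j Q)"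
      using "3.IH" "3.prems"(1) unfolding die_out.simps by blast
    then show ?thesis by (intro bexI[of _ j]) auto
  next
    case False
    then show ?thesis by (intro bexI[of _ "n + 1"]) auto
  qed
qed auto

lemma early_sums_eq: "early_sums c Q = map fst (filter (\<lambda>p. fst p \<le> c) Q)"
  by (induction c Q rule: early_sums.induct) auto

lemma all_above_iff: "all_above a ss \<longleftrightarrow> (\<forall>s\<in>set ss. a < s)"
  by (induction a ss rule: all_above.induct) auto

lemma searches_fail_iff:
  "searches_fail a b ls Qs \<longleftrightarrow>
     (\<forall>Q\<in>set Qs. settled a (early_sums (a + 5) Q) \<or> search_fails a b ls Q)"
  by (induction Qs) auto

text \<open>
  A lone option with sum \<open>s0\<close> must be used for each of \<open>a, \<dots>, a + 5\<close>. What completes it are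
  partitions of \<open>a - s0, \<dots>, a + 5 - s0\<close> with one common reciprocal sum, and this lower window
  is blocked.
\<close>

lemma settled_sound:
  assumes IH: "\<forall>m<a. m \<le> 52 \<longrightarrow> blocked m (m + 5)" and b: "a + 5 \<le> b"
    and U: "\<forall>u\<in>set U. 0 < u" and L: "0 < L"
    and "settled (int a) (early_sums (int a + 5) Q)"
  shows "\<not> (\<forall>n\<in>{a..b}. solves U L Q x n)"
proof
  assume sol: "\<forall>n\<in>{a..b}. solves U L Q x n"
  let ?E = "filter (\<lambda>p. fst p \<le> int a + 5) Q"
  have ent: "\<exists>s v A. (s, v) \<in> set ?E \<and> s \<le> int n \<and> finite A \<and> int ` A \<subseteq> set U \<and>
      s + int (\<Sum>A) = int n \<and> x = of_int v + (\<Sum>k\<in>A. of_int L / of_nat k)"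
    if n: "n \<in> {a..a + 5}" for n
  proof -
    obtain s v A where *: "(s, v) \<in> set Q" "finite A" "int ` A \<subseteq> set U"
      "s + int (\<Sum>A) = int n" "x = of_int v + (\<Sum>k\<in>A. of_int L / of_nat k)"
      using sol n b unfolding solves_def by (meson atLeastAtMost_iff le_trans)
    moreover have "s \<le> int n" using *(4) by linarith
    ultimately show ?thesis using n by (intro exI[of _ s] exI[of _ v] exI[of _ A]) auto
  qed
  obtain s0 v0 where s0: "(s0, v0) \<in> set ?E" "s0 \<le> int a" using ent[of a] by auto
  then have "\<not> all_above (int a) (map fst ?E)" by (force simp: all_above_iff)
  moreover have "?E \<noteq> []" using s0(1) by (metis empty_iff list.set(1))
  moreover have "settled (int a) (map fst ?E)" using assms(5) by (simp add: early_sums_eq)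
  ultimately obtain p where E: "?E = [p]" "int a < fst p \<or> 0 < fst p \<and> int a - fst p \<le> 52"
    by (cases "(int a, map fst ?E)" rule: settled.cases) auto
  then have p: "p = (s0, v0)" using s0 by auto
  then have s: "0 < s0" "int a - s0 \<le> 52" using E s0 by auto
  define m where "m = a - nat s0"
  have m: "int m = int a - s0" using s0 s by (simp add: m_def)
  have "\<exists>A. alpha_partition ((x - of_int v0) / of_int L) n A" if n: "n \<in> {m..m + 5}" for n
  proof -
    have "n + nat s0 \<in> {a..a + 5}" using n m s by auto
    from ent[OF this] obtain A where A: "finite A" "int ` A \<subseteq> set U"
      "s0 + int (\<Sum>A) = int (n + nat s0)" "x = of_int v0 + (\<Sum>k\<in>A. of_int L / of_nat k)"
      by (auto simp: E(1) p)
    have "(\<Sum>k\<in>A. of_int L / of_nat k) = of_int L * (\<Sum>k\<in>A. 1 / of_nat k :: rat)"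
      by (simp add: sum_distrib_left)
    then have "(\<Sum>k\<in>A. 1 / of_nat k) = (x - of_int v0) / of_int L"
      using A(4) L by simp
    moreover have "\<forall>k\<in>A. 0 < k" using A(2) U by fastforce
    moreover have "int (\<Sum>A) = int n" using A(3) s by linarith
    then have "\<Sum>A = n" by (simp only: of_nat_eq_iff)
    ultimately show ?thesis using A(1) by (auto simp: alpha_partition_def)
  qed
  then have "\<not> blocked m (m + 5)" unfolding blocked_def by blast
  moreover have "m < a" "m \<le> 52" using m s by auto
  ultimately show False using IH by blast
qed

text \<open>
  At a leaf, \<open>x\<close> would have to be among the completions for every \<open>n\<close> of the window.
\<close>

lemma search_fails_sound:
  assumes IH: "\<forall>m<a. m \<le> 52 \<longrightarrow> blocked m (m + 5)" and b: "a + 5 \<le> b"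
    and "valid ls" "search_fails (int a) (int b) ls Q"
  shows "\<not> (\<forall>n\<in>{a..b}. solves (pool ls) (denominator ls) Q x n)"
  using assms(3,4)
proof (induction ls arbitrary: Q x)
  case Nil
  show ?case
  proof
    assume sol: "\<forall>n\<in>{a..b}. solves (pool []) (denominator []) Q x n"
    then have c: "x \<in> of_int ` set (completions (int n) Q)" if "n \<in> {a..b}" for n
      using that solves_completions by blast
    obtain y where y: "y \<in> set (completions (int a) Q)" "x = of_int y"
      using c[of a] b by auto
    have "die_out Q (int a) (nat (int b - int a)) (completions (int a) Q)"
      using Nil.prems by simp
    from die_out_sound[OF this y(1)] obtain j
      where j: "j \<in> {int a<..int a + int (nat (int b - int a))}" "y \<notin> set (completions j Q)"
      by blast
    then have "int (nat j) = j" "nat j \<in> {a..b}" using b by auto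
    then show False using c[of "nat j"] j(2) y(2) by auto
  qed
next
  case (Cons l ls)
  have v: "valid ls" using Cons.prems by simp
  show ?case
  proof
    assume "\<forall>n\<in>{a..b}. solves (pool (l # ls)) (denominator (l # ls)) Q x n"
    from solves_level[OF Cons.prems(1) this] obtain Q' y where Q':
      "Q' \<in> set (residue_classes [0..base l - 1]
        (extend_all (base l) (int b) (weights l) (digits (base l) Q)))"
      "\<forall>n\<in>{a..b}. solves (pool ls) (denominator ls) Q' y n" .
    then have "settled (int a) (early_sums (int a + 5) Q') \<or> search_fails (int a) (int b) ls Q'"
      using Cons.prems(2) by (simp add: searches_fail_iff)
    then show False
      using settled_sound[OF IH b _ denominator_pos[OF v]] pool_pos[OF v] Cons.IH[OF v] Q'(2)
      by blast
  qed
qed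

section \<open>The blocked windows\<close>

text \<open>
  Up to 78, the levels and the powers of two contain every number whose prime factors are at
  most 13.
\<close>

lemma large_prime_or_pool:
  assumes "0 < k" "k \<le> 78"
  shows "(\<exists>p. prime p \<and> 17 \<le> p \<and> p dvd k) \<or> int k \<in> set (pool levels)"
proof -
  let ?ps = "[17, 19, 23, 29, 31, 37, 41, 43, 47, 53, 59, 61, 67, 71, 73 :: int]"
  have "list_all (\<lambda>u. list_ex (\<lambda>p. p dvd u) ?ps \<or> u \<in> set (pool levels)) [1..78]"
    by code_simp
  then have "list_ex (\<lambda>p. p dvd int k) ?ps \<or> int k \<in> set (pool levels)"
    unfolding list_all_iff using assms by auto
  moreover have "prime (nat p) \<and> 17 \<le> nat p \<and> nat p dvd k"
    if "p \<in> set ?ps" "p dvd int k" for p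
  proof
    show "prime (nat p)" using that(1) by auto
    have "int (nat p) = p" using that(1) by auto
    then show "17 \<le> nat p \<and> nat p dvd k"
      using that by (auto simp flip: int_dvd_int_iff)
  qed
  ultimately show ?thesis unfolding list_ex_iff by blast
qed

lemma blocked_step:
  assumes IH: "\<forall>m<a. m \<le> 52 \<longrightarrow> blocked m (m + 5)" and ab: "a + 5 \<le> b" "b \<le> 78" "a \<le> 69"
    and ref: "search_fails (int a) (int b) levels [(0, 0)]"
  shows "blocked a b"
  unfolding blocked_def
proof
  assume "\<exists>\<alpha>. \<forall>n\<in>{a..b}. \<exists>A. alpha_partition \<alpha> n A"
  then obtain \<alpha> A where A: "\<forall>n\<in>{a..b}. alpha_partition \<alpha> n (A n)" by metis
  let ?L = "denominator levels"
  have "solves (pool levels) ?L [(0, 0)] (of_int ?L * \<alpha>) n" if n: "n \<in> {a..b}" for n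
  proof (rule solvesI)
    have An: "finite (A n)" "\<forall>k\<in>A n. 0 < k" "\<Sum>(A n) = n" "(\<Sum>k\<in>A n. 1 / of_nat k) = \<alpha>"
      using A n by (auto simp: alpha_partition_def)
    show "(0, 0) \<in> set [(0, 0)]" "finite (A n)" "0 + int (\<Sum>(A n)) = int n"
      using An by simp_all
    show "int ` A n \<subseteq> set (pool levels)"
    proof
      fix u assume "u \<in> int ` A n"
      then obtain k where k: "k \<in> A n" "u = int k" by auto
      have "k \<le> \<Sum>(A n)" using k(1) An(1) by (intro member_le_sum) auto
      then have "k \<le> 78" using An(3) n ab by auto
      moreover have "\<not> p dvd k" if "prime p" "17 \<le> p" for p
        using no_large_prime_divisor[OF IH ab(1) _ ab(3) A that n k(1)] ab(2) by simp
      ultimately show "u \<in> set (pool levels)"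
        using large_prime_or_pool[of k] An(2) k by auto
    qed
    have "of_int ?L * (\<Sum>k\<in>A n. 1 / of_nat k) = (\<Sum>k\<in>A n. of_int ?L / of_nat k :: rat)"
      by (simp add: sum_distrib_left)
    then show "of_int ?L * \<alpha> = of_int 0 + (\<Sum>k\<in>A n. of_int ?L / of_nat k)"
      using An(4) by simp
  qed
  then show False using search_fails_sound[OF IH ab(1) valid_levels ref] by blast
qed

lemma windows_failD:
  "windows_fail ms \<Longrightarrow> m \<in> set ms \<Longrightarrow> search_fails m (m + 5) levels [(0, 0)]"
  by (induction ms) auto

text \<open>
  A failing search shows that its window is blocked only once the lower windows are known to
  be; hence the induction in \<open>blocked_short\<close>.
\<close>

lemma short_windows_fail: "windows_fail [0..52]"
  by code_simp

lemma long_window_fails: "search_fails 65 78 levels [(0, 0)]"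
  by code_simp

text \<open>
  The bound 52 is what the reductions ask for: deleting multiples of a prime \<open>p \<ge> 17\<close> from a
  partition of at most 69, or a lone option with sum at least 13 from one of 65, leads to a
  number of at most 52.
\<close>

lemma blocked_short: "m \<le> 52 \<Longrightarrow> blocked m (m + 5)"
proof (induction m rule: less_induct)
  case (less m)
  have "search_fails (int m) (int m + 5) levels [(0, 0)]"
    using windows_failD[OF short_windows_fail] less.prems by simp
  then show ?case
    using less by (intro blocked_step) (auto simp: add.commute)
qed

lemma blocked_long: "blocked 65 78"
  using long_window_fails blocked_short by (intro blocked_step) auto

section \<open>The lower bound\<close>

theorem theorem3:
  fixes \<alpha> :: rat
  assumes "0 < \<alpha>"
  shows "66 \<le> n_alpha \<alpha>"
proof (rule ccontr)
  assume "\<not> 66 \<le> n_alpha \<alpha>"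
  then have "Inf (enat ` {N. eventually_partitionable \<alpha> N}) < 66"
    by (simp add: n_alpha_def)
  then obtain N where N: "eventually_partitionable \<alpha> N" "enat N < 66"
    by (auto simp: Inf_less_iff)
  then have "N \<le> 65" by (simp add: numeral_eq_enat)
  then have "\<forall>n\<in>{65..78}. \<exists>A. alpha_partition \<alpha> n A"
    using N(1) by (auto simp: eventually_partitionable_def)
  then show False using blocked_long unfolding blocked_def by blast
qed

end
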